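(* Let $L\ge2$ and let $[0,1]^2=S_0\supset S_1\supset S_2\supset\cdots$ be any sequence of sets such that for each $n$, $S_n$ is the union of $L^n$ squares of $\mathcal{D}_n$, one from each column of the $L^n\times L^n$ grid. Then there is a constant $c>0$ depending only on $L$ such that \[ \operatorname{Fav}(S_n)\ge c\,\frac{\log n}{n}\qquad\text{for all } n\ge2. \]
   Context: $\mathcal{D}_n$ is the set of closed squares obtained by dividing $[0,1]^2$ into an $L^n\times L^n$ grid. $\operatorname{Fav}(A)=\int_0^\pi|\operatorname{proj}_\theta A|\,d\theta$ where $\operatorname{proj}_\theta(x)=\langle x,(-\sin\theta,\cos\theta)\rangle$ and $|\cdot|$ is one-dimensional Lebesgue measure. *)

theory Defs
  imports "HOL-Analysis.Analysis"
begin

definition grid_square :: "nat \<Rightarrow> nat \<Rightarrow> nat \<Rightarrow> nat \<Rightarrow> (real \<times> real) set" where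
  "grid_square L n i j =
     {real i / real L ^ n .. (real i + 1) / real L ^ n} \<times>
     {real j / real L ^ n .. (real j + 1) / real L ^ n}"

definition proj :: "real \<Rightarrow> real \<times> real \<Rightarrow> real" where
  "proj \<theta> p = - fst p * sin \<theta> + snd p * cos \<theta>"

definition Fav :: "(real \<times> real) set \<Rightarrow> real" where
  "Fav A = integral {0..pi} (\<lambda>\<theta>. measure lebesgue (proj \<theta> ` A))"

definition one_per_column :: "nat \<Rightarrow> nat \<Rightarrow> (real \<times> real) set \<Rightarrow> bool" where
  "one_per_column L n S \<longleftrightarrow>
     (\<exists>f :: nat \<Rightarrow> nat. (\<forall>i < L ^ n. f i < L ^ n) \<and>
        S = (\<Union>i < L ^ n. grid_square L n i (f i)))"

end

(*
Project along angles with u = tan theta in [1, n]. The projection of S_n at such an angle contains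
the L^n projected bottom edges of its squares, of total length sin theta, and the expected
multiplicity of this cover is of order n / u. The reason is nestedness: if two columns at distance
d L^-n lie in the same column of generation n - k but not of generation n - k + 1, then the squares
in them have vertical distance at most L^k L^-n, and only a proportion d / L^(k-1) of the columns i
is separated from i + d in this way. Since overlap at u in [1, n] forces the vertical distance to be
at most 2 n d L^-n, each of the n levels k contributes to the average overlap only
sum_(d <= L^k) min(1/d, 2n/L^k), which is of order log n. A second moment argument thus bounds the
projection below by a multiple of u / n, and the integral of tan theta / n over these angles is of
order log n / n.
*)
theory Submission
  imports Defs
begin

section \<open>Second moment bound for unions of intervals\<close>

text \<open>
  Linearised Cauchy-Schwarz: the multiplicity function \<open>F\<close> of the intervals satisfies
  \<open>2 l F - l\<^sup>2 F\<^sup>2 \<le> 1\<close>. Unlike the quotient \<open>(\<integral>F)\<^sup>2 / \<integral>F\<^sup>2\<close>, the bound stays linear in the pair overlaps,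
  so that it can be integrated over the angle with an angle-dependent \<open>l\<close>.
\<close>
lemma measure_Union_intervals_ge:
  fixes x :: "'a \<Rightarrow> real"
  assumes A: "finite A" and w: "0 \<le> w"
  shows "2 * l * real (card A) * w - l\<^sup>2 * (\<Sum>i\<in>A. \<Sum>j\<in>A. if \<bar>x i - x j\<bar> < w then w else 0)
         \<le> measure lebesgue (\<Union>i\<in>A. {x i..x i + w})"
proof -
  define I where "I i = {x i..x i + w}" for i
  define U where "U = (\<Union>i\<in>A. I i)"
  define F where "F y = (\<Sum>i\<in>A. indicator (I i) y :: real)" for y
  have Im: "I i \<in> lmeasurable" and Im2: "I i \<inter> I j \<in> lmeasurable" for i j
    by (auto simp: I_def)
  have U: "U \<in> lmeasurable"
    unfolding U_def using A Im by (intro fmeasurable.finite_UN) auto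
  have F2: "(F y)\<^sup>2 = (\<Sum>i\<in>A. \<Sum>j\<in>A. indicator (I i \<inter> I j) y)" for y
    by (simp add: F_def power2_eq_square sum_product indicator_inter_arith)
  have int_ind: "integrable lebesgue (indicator B :: real \<Rightarrow> real)"
      "integral\<^sup>L lebesgue (indicator B) = measure lebesgue B" if "B \<in> lmeasurable" for B :: "real set"
    using that by (auto simp: fmeasurable_def)
  have iF: "integrable lebesgue F" and iF2: "integrable lebesgue (\<lambda>y. (F y)\<^sup>2)"
    unfolding F2 unfolding F_def
    by (intro Bochner_Integration.integrable_sum int_ind(1) Im Im2)+
  have vF: "integral\<^sup>L lebesgue F = card A * w"
    unfolding F_def
    by (subst Bochner_Integration.integral_sum) (use int_ind Im w in \<open>auto simp: I_def\<close>)
  \<comment> \<open>Closed intervals whose left ends are exactly \<open>w\<close> apart share a null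
    set, so the strict inequality suffices; a genuine overlap is bounded crudely by its largest
    possible length \<open>w\<close>.\<close>
  have ov: "measure lebesgue (I i \<inter> I j) \<le> (if \<bar>x i - x j\<bar> < w then w else 0)" for i j
    using w by (auto simp: I_def Int_atLeastAtMost)
  have vF2: "integral\<^sup>L lebesgue (\<lambda>y. (F y)\<^sup>2) = (\<Sum>i\<in>A. \<Sum>j\<in>A. measure lebesgue (I i \<inter> I j))"
    unfolding F2
    by (simp add: Bochner_Integration.integral_sum Bochner_Integration.integrable_sum int_ind Im2)
  have pw: "2 * l * F y - l\<^sup>2 * (F y)\<^sup>2 \<le> indicator U y" for y
  proof (cases "y \<in> U")
    case True
    have "0 \<le> (l * F y - 1)\<^sup>2" by simp
    then show ?thesis using True by (simp add: power2_eq_square algebra_simps)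
  next
    case False
    then have "F y = 0" unfolding F_def U_def by (intro sum.neutral) auto
    then show ?thesis by simp
  qed
  have "2 * l * (card A * w) - l\<^sup>2 * (\<Sum>i\<in>A. \<Sum>j\<in>A. measure lebesgue (I i \<inter> I j))
      = (\<integral>y. 2 * l * F y - l\<^sup>2 * (F y)\<^sup>2 \<partial>lebesgue)"
    using iF iF2 by (simp add: vF vF2)
  also have "\<dots> \<le> (\<integral>y. indicator U y \<partial>lebesgue)"
    by (intro integral_mono) (use iF iF2 U int_ind pw in auto)
  also have "\<dots> = measure lebesgue U" using int_ind U by auto
  finally have "2 * l * (card A * w) - l\<^sup>2 * (\<Sum>i\<in>A. \<Sum>j\<in>A. measure lebesgue (I i \<inter> I j)) \<le> measure lebesgue U" .
  moreover have "l\<^sup>2 * (\<Sum>i\<in>A. \<Sum>j\<in>A. measure lebesgue (I i \<inter> I j))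
     \<le> l\<^sup>2 * (\<Sum>i\<in>A. \<Sum>j\<in>A. if \<bar>x i - x j\<bar> < w then w else 0)"
    by (intro mult_left_mono sum_mono ov) auto
  ultimately show ?thesis by (simp add: U_def I_def mult.assoc)
qed

section \<open>Lower bounds for the Favard length\<close>

lemma Fav_ge_integral:
  assumes A: "compact A" and J: "{a..b} \<subseteq> {0..pi}"
    and phi: "(\<phi> has_integral v) {a..b}"
    and le: "\<And>\<theta>. \<theta> \<in> {a..b} \<Longrightarrow> \<phi> \<theta> \<le> measure lebesgue (proj \<theta> ` A)"
  shows "v \<le> Fav A"
proof -
  define g where "g \<theta> = measure lebesgue (proj \<theta> ` A)" for \<theta>
  \<comment> \<open>\<open>Fav\<close> is \<open>0\<close> if its integrand is not integrable; measurability holds because \<open>K\<close> is compact with slices \<open>proj \<theta> ` A\<close>.\<close>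
  define K where "K = (\<lambda>q. (fst q, proj (fst q) (snd q))) ` ({0..pi} \<times> A)"
  have K: "compact K"
    unfolding K_def proj_def
    by (intro compact_continuous_image continuous_intros compact_Times A) auto
  have sl: "proj \<theta> ` A = Pair \<theta> -` K" if "\<theta> \<in> {0..pi}" for \<theta>
    using that unfolding K_def by force
  have comp: "compact (proj \<theta> ` A)" for \<theta>
    unfolding proj_def by (intro compact_continuous_image continuous_intros A)
  have gK: "g \<theta> = measure lborel (Pair \<theta> -` K)" if "\<theta> \<in> {0..pi}" for \<theta>
  proof -
    have "proj \<theta> ` A \<in> sets lborel"
      using borel_closed[OF compact_imp_closed[OF comp]] by simp
    then show ?thesis unfolding g_def sl[OF that, symmetric] by (rule measure_completion)
  qed
  have Km: "K \<in> sets (borel \<Otimes>\<^sub>M lborel :: (real \<times> real) measure)"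
    using borel_closed[OF compact_imp_closed[OF K]]
    by (simp add: borel_prod[symmetric] cong: sets_pair_measure_cong)
  have gm: "(\<lambda>\<theta>. measure lborel (Pair \<theta> -` K)) \<in> borel_measurable borel"
    unfolding measure_def
    by (intro borel_measurable_enn2real lborel.measurable_emeasure_Pair Km)
  obtain B where B: "\<And>q. q \<in> A \<Longrightarrow> norm q \<le> B" "0 \<le> B"
    using compact_imp_bounded[OF A] by (metis bounded_pos less_eq_real_def)
  have gb: "g \<theta> \<le> 4 * B" for \<theta>
  proof -
    have "proj \<theta> ` A \<subseteq> {- 2 * B..2 * B}"
    proof (clarify)
      fix x y assume q: "(x, y) \<in> A"
      have "\<bar>x\<bar> \<le> B" "\<bar>y\<bar> \<le> B"
        using B(1)[OF q] norm_fst_le[of x y] norm_snd_le[of y x] by auto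
      moreover have "\<bar>x * sin \<theta>\<bar> \<le> \<bar>x\<bar>" "\<bar>y * cos \<theta>\<bar> \<le> \<bar>y\<bar>"
        by (simp_all add: abs_mult mult_left_le)
      ultimately show "proj \<theta> (x, y) \<in> {- 2 * B..2 * B}" by (auto simp: proj_def)
    qed
    then have "g \<theta> \<le> measure lebesgue {- 2 * B..2 * B}"
      unfolding g_def using fmeasurableD[OF lmeasurable_compact[OF comp]]
      by (intro measure_mono_fmeasurable) auto
    then show ?thesis using B by simp
  qed
  have gint: "g integrable_on {0..pi}"
  proof -
    have "set_integrable lebesgue {0..pi} (\<lambda>\<theta>. measure lborel (Pair \<theta> -` K))"
      unfolding set_integrable_def
    proof (rule integrableI_bounded_set_indicator[where B="4 * B"])
      show "(\<lambda>\<theta>. measure lborel (Pair \<theta> -` K)) \<in> borel_measurable lebesgue"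
        using gm by (simp add: measurable_completion)
      show "AE x\<in>{0..pi} in lebesgue. norm (measure lborel (Pair x -` K)) \<le> 4 * B"
        using gb by (intro AE_I2) (auto simp: g_def simp flip: gK)
    qed auto
    then have "(\<lambda>\<theta>. measure lborel (Pair \<theta> -` K)) integrable_on {0..pi}"
      using set_lebesgue_integral_eq_integral(1) by blast
    then show ?thesis by (rule integrable_eq) (simp add: gK)
  qed
  have gab: "g integrable_on {a..b}"
    by (rule integrable_on_subinterval[OF gint J])
  have "v = integral {a..b} \<phi>" using phi by (simp add: integral_unique)
  also have "\<dots> \<le> integral {a..b} g"
    using phi le gab
    by (intro integral_le) (auto simp: g_def)
  also have "\<dots> \<le> integral {0..pi} g"
    using gint gab J
    by (intro integral_subset_le) (auto simp: g_def)
  finally show ?thesis by (simp add: Fav_def g_def[abs_def])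
qed

section \<open>Overlap of two projected edges as the angle varies\<close>

text \<open>
  For two squares whose columns differ by \<open>d\<close> and whose rows differ by \<open>h\<close> (in units of the side
  length), the projections of the bottom edges overlap at angle \<open>\<theta>\<close> iff
  \<open>\<bar>d u - h\<bar> < u\<close> with \<open>u = tan \<theta>\<close>; this bounds the length of the set of such \<open>u \<in> [1, n]\<close>.
\<close>
definition overlap_bound :: "nat \<Rightarrow> int \<Rightarrow> int \<Rightarrow> real" where
  "overlap_bound n d h =
     (if \<bar>d\<bar> \<le> 1 then real n
      else if \<bar>h\<bar> \<le> 2 * int n * \<bar>d\<bar> then 3 * \<bar>real_of_int h\<bar> / (real_of_int d)\<^sup>2 else 0)"

lemma overlap_bound_minus: "overlap_bound n (- d) (- h) = overlap_bound n d h"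
  by (simp add: overlap_bound_def)

text \<open>For \<open>d \<ge> 2\<close> the condition reads h/(d+1) < u < h/(d-1), an interval of
  length 2h/(d^2-1) \<le> 3h/d^2, and some u in [1, n] satisfies it only if 1 \<le> h \<le> n(d+1)
  \<le> 2nd. Negative \<open>d\<close> follows by symmetry, and for |d| \<le> 1 all of [1, n]
  serves. A closed window is provided because its integral over the angle is explicit.\<close>

lemma overlap_window:
  assumes n: "1 \<le> n"
  shows "\<exists>\<alpha> \<beta>. 1 \<le> \<alpha> \<and> \<alpha> \<le> \<beta> \<and> \<beta> \<le> real n \<and> \<beta> - \<alpha> \<le> overlap_bound n d h \<and>
    (\<forall>u\<in>{1..real n}. \<bar>real_of_int d * u - real_of_int h\<bar> < u \<longrightarrow> u \<in> {\<alpha>..\<beta>})"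
    (is "?W d h")
proof -
  have pos: "?W d h" if d: "d \<ge> 2" for d h :: int
  proof -
    define \<alpha> where "\<alpha> = max 1 (real_of_int h / (real_of_int d + 1))"
    define \<beta> where "\<beta> = min (real n) (real_of_int h / (real_of_int d - 1))"
    have d': "real_of_int d \<ge> 2" using d by simp
    have sub: "u \<in> {\<alpha>..\<beta>}" if "u \<in> {1..real n}" "\<bar>real_of_int d * u - real_of_int h\<bar> < u" for u
      using that d' by (auto simp: \<alpha>_def \<beta>_def field_simps abs_less_iff)
    have nonneg: "0 \<le> overlap_bound n d h" by (simp add: overlap_bound_def)
    show "?W d h"
    proof (cases "\<alpha> \<le> \<beta>")
      case False
      then have "\<not> \<bar>real_of_int d * u - real_of_int h\<bar> < u" if "u \<in> {1..real n}" for u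
        using sub[OF that] by auto
      \<comment> \<open>No overlap occurs, so the degenerate window at 1 will do.\<close>
      then show "?W d h" using n nonneg by (intro exI[of _ 1]) auto
    next
      case True
      have "1 \<le> real_of_int h / (real_of_int d - 1)" "real_of_int h / (real_of_int d + 1) \<le> real n"
        using True by (auto simp: \<alpha>_def \<beta>_def)
      then have h: "real_of_int h \<ge> 1" "real_of_int h \<le> real n * (real_of_int d + 1)"
        using d' by (auto simp: field_simps)
      have "real n * (real_of_int d + 1) \<le> real n * (2 * real_of_int d)"
        using d' by (intro mult_left_mono) auto
      then have "real_of_int h \<le> real_of_int (2 * int n * \<bar>d\<bar>)" using h d by simp
      then have "\<bar>h\<bar> \<le> 2 * int n * \<bar>d\<bar>" using h by linarith
      then have ob: "overlap_bound n d h = 3 * real_of_int h / (real_of_int d)\<^sup>2"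
        using d h by (simp add: overlap_bound_def)
      have "\<beta> - \<alpha> \<le> real_of_int h / (real_of_int d - 1) - real_of_int h / (real_of_int d + 1)"
        by (simp add: \<alpha>_def \<beta>_def)
      also have "\<dots> = 2 * real_of_int h / ((real_of_int d)\<^sup>2 - 1)"
        using d' by (simp add: field_simps power2_eq_square)
      also have "\<dots> \<le> 3 * real_of_int h / (real_of_int d)\<^sup>2"
      proof -
        have "2 * 2 \<le> real_of_int d * real_of_int d" using d' by (intro mult_mono) auto
        then have sq: "4 \<le> (real_of_int d)\<^sup>2" by (simp add: power2_eq_square)
        have "real_of_int h * (2 * (real_of_int d)\<^sup>2) \<le> real_of_int h * (3 * ((real_of_int d)\<^sup>2 - 1))"
          using h sq by (intro mult_left_mono) auto
        then show ?thesis using sq d by (simp add: divide_simps mult_ac)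
      qed
      finally show "?W d h" using True sub ob by (intro exI[of _ \<alpha>] exI[of _ \<beta>]) (auto simp: \<alpha>_def \<beta>_def)
    qed
  qed
  consider "\<bar>d\<bar> \<le> 1" | "d \<ge> 2" | "- d \<ge> 2" by linarith
  then show ?thesis
  proof cases
    case 1
    then show ?thesis using n by (intro exI[of _ 1] exI[of _ "real n"]) (auto simp: overlap_bound_def)
  next
    case 2
    then show ?thesis by (rule pos)
  next
    case 3
    have "\<bar>real_of_int (- d) * u - real_of_int (- h)\<bar> = \<bar>real_of_int d * u - real_of_int h\<bar>" for u
      by (simp add: abs_if)
    then show ?thesis using pos[OF 3, of "- h"] by (simp add: overlap_bound_minus)
  qed
qed

section \<open>Counting separated columns and logarithmic sums\<close>

text \<open>Adding \<open>d\<close> moves only the last \<open>d\<close> positions of a block of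
  length \<open>b\<close> out of it, and there are \<open>N div b\<close> blocks;
  \<open>(q, r)\<close> encodes the block and the distance from its end.\<close>

lemma card_div_neq_add_div_le:
  fixes N b d :: nat
  assumes "b > 0" "b dvd N"
  shows "card {i. i < N \<and> i div b \<noteq> (i + d) div b} \<le> N div b * d"
proof -
  have "{i. i < N \<and> i div b \<noteq> (i + d) div b} \<subseteq> (\<lambda>(q, r). (q + 1) * b - (r + 1)) ` ({..<N div b} \<times> {..<d})"
  proof
    fix i assume "i \<in> {i. i < N \<and> i div b \<noteq> (i + d) div b}"
    then have i: "i < N" "i div b \<noteq> (i + d) div b" by auto
    define q where "q = i div b"
    have q: "i < (q + 1) * b" using assms(1) unfolding q_def
      by (simp add: dividend_less_div_times add.commute)
    have "i div b \<le> (i + d) div b" by (simp add: div_le_mono)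
    with i have "q + 1 \<le> (i + d) div b" by (simp add: q_def)
    then have r: "(q + 1) * b \<le> i + d" using assms(1) by (simp add: less_eq_div_iff_mult_less_eq)
    have "q < N div b" using i(1) assms unfolding q_def
      by (metis dvd_div_mult_self div_less_iff_less_mult)
    moreover have "(q + 1) * b - i - 1 < d" using q r by linarith
    moreover have "i = (q + 1) * b - (((q + 1) * b - i - 1) + 1)" using q by linarith
    ultimately show "i \<in> (\<lambda>(q, r). (q + 1) * b - (r + 1)) ` ({..<N div b} \<times> {..<d})"
      by (intro image_eqI[of _ _ "(q, (q + 1) * b - i - 1)"]) auto
  qed
  then have "card {i. i < N \<and> i div b \<noteq> (i + d) div b} \<le> card ({..<N div b} \<times> {..<d})"
    by (rule surj_card_le[rotated]) simp
  then show ?thesis by simp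
qed

text \<open>The bound telescopes: ln t \<le> t - 1 at t = (d-1+y)/(d+y) gives 1/(d+y) \<le>
  ln((d+y)/(d-1+y)).\<close>

lemma sum_inverse_add_le_ln:
  fixes y :: real
  assumes "y > 0"
  shows "(\<Sum>d=1..K. 1 / (real d + y)) \<le> ln ((real K + y) / y)"
proof (induction K)
  case (Suc K)
  have "1 / (real (Suc K) + y) \<le> ln ((real (Suc K) + y) / (real K + y))"
    using ln_le_minus_one[of "(real K + y) / (real (Suc K) + y)"] assms
    by (simp add: ln_div field_simps)
  then show ?case using Suc assms by (simp add: ln_div)
qed (use assms in simp)

text \<open>The two bounds cross at y = K/(2n), and min(1/d, 1/y) \<le> 2/(d+y) smooths the minimum
  into a summable form.\<close>

lemma sum_min_inverse_le_ln:
  fixes K n :: nat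
  assumes "K > 0" "n > 0"
  shows "(\<Sum>d=1..K. min (1 / real d) (2 * real n / real K)) \<le> 2 * ln (1 + 2 * real n)"
proof -
  define y where "y = real K / (2 * real n)"
  have y: "y > 0" using assms by (simp add: y_def)
  have "min (1 / real d) (2 * real n / real K) \<le> 2 * (1 / (real d + y))" if "d \<in> {1..K}" for d
  proof -
    have e: "2 * real n / real K = 1 / y" using assms by (simp add: y_def)
    show ?thesis unfolding e using that y
      by (cases "real d \<le> y") (auto simp: min_def field_simps)
  qed
  then have "(\<Sum>d=1..K. min (1 / real d) (2 * real n / real K)) \<le> (\<Sum>d=1..K. 2 * (1 / (real d + y)))"
    by (intro sum_mono)
  also have "\<dots> \<le> 2 * ln ((real K + y) / y)"
    unfolding sum_distrib_left[symmetric] using sum_inverse_add_le_ln[OF y] by simp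
  also have "(real K + y) / y = 1 + 2 * real n" using assms by (simp add: y_def field_simps)
  finally show ?thesis .
qed

section \<open>Total overlap over all pairs of columns\<close>

lemma sum_square_symmetric:
  fixes c :: "nat \<Rightarrow> nat \<Rightarrow> real"
  assumes "\<And>i j. c i j = c j i"
  shows "(\<Sum>i<N. \<Sum>j<N. c i j) = (\<Sum>i<N. c i i) + 2 * (\<Sum>i<N. \<Sum>d\<in>{1..<N - i}. c i (i + d))"
proof -
  let ?u = "\<lambda>i j. if i < j then c i j else 0"
  have up: "(\<Sum>j<N. ?u i j) = (\<Sum>d\<in>{1..<N - i}. c i (i + d))" for i
  proof -
    have "(\<Sum>j<N. ?u i j) = (\<Sum>j\<in>{i<..<N}. c i j)"
      by (intro sum.mono_neutral_cong_right) auto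
    also have "\<dots> = (\<Sum>d\<in>{1..<N - i}. c i (i + d))"
      by (rule sum.reindex_bij_witness[of _ "\<lambda>d. i + d" "\<lambda>j. j - i"]) auto
    finally show ?thesis .
  qed
  have "(\<Sum>i<N. \<Sum>j<N. c i j) = (\<Sum>i<N. \<Sum>j<N. (if i = j then c i i else 0) + ?u i j + ?u j i)"
    using assms by (intro sum.cong refl) auto
  also have "\<dots> = (\<Sum>i<N. c i i) + (\<Sum>i<N. \<Sum>j<N. ?u i j) + (\<Sum>i<N. \<Sum>j<N. ?u j i)"
    by (simp add: sum.distrib)
  also have "(\<Sum>i<N. \<Sum>j<N. ?u j i) = (\<Sum>i<N. \<Sum>j<N. ?u i j)"
    by (rule sum.swap)
  finally show ?thesis by (simp add: up)
qed

text \<open>Diagonal pairs contribute N n and pairs of neighbours at most 2 N n, whence the 3. For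
  the rest, each of the n levels of the smallest common ancestor contributes at most 6 N L ln(1+2n),
  doubled for the two orders of a pair.\<close>

lemma sum_overlap_bound_le:
  fixes L n :: nat and f :: "nat \<Rightarrow> nat"
  assumes L: "L \<ge> 2" and n: "n \<ge> 1"
    and nested: "\<And>k i j. \<lbrakk>k \<le> n; i < L ^ n; j < L ^ n; i div L ^ k = j div L ^ k\<rbrakk>
                   \<Longrightarrow> f i div L ^ k = f j div L ^ k"
  shows "(\<Sum>i<L ^ n. \<Sum>j<L ^ n. overlap_bound n (int i - int j) (int (f i) - int (f j)))
         \<le> real (L ^ n) * real n * (3 + 12 * real L * ln (1 + 2 * real n))"
proof -
  define N where "N = L ^ n"
  define c where "c i j = overlap_bound n (int i - int j) (int (f i) - int (f j))" for i j
  define G where "G k d = 3 * min (real (L ^ k)) (2 * real n * real d) / (real d)\<^sup>2" for k d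
  \<comment> \<open>Columns separated at one level are also separated at all finer levels, so the
    sum may contain more than the term of the smallest common ancestor; the extra terms are
    nonnegative. Neighbours are set apart because \<open>overlap_bound\<close> is \<open>n\<close>
    there.\<close>
  define T where "T i d = (if d = 1 then real n else 0) +
      (\<Sum>k=1..n. if d \<le> L ^ k \<and> i div L ^ (k - 1) \<noteq> (i + d) div L ^ (k - 1) then G k d else 0)" for i d
  have G0: "0 \<le> G k d" for k d by (simp add: G_def)
  have T0: "0 \<le> T i d" for i d unfolding T_def using G0 by (intro add_nonneg_nonneg sum_nonneg) auto
  have cT: "c i (i + d) \<le> T i d" if "i + d < N" "1 \<le> d" for i d
  proof (cases "d = 1")
    case True
    have "c i (i + d) = real n" using True by (simp add: c_def overlap_bound_def)
    also have "\<dots> \<le> T i d" unfolding T_def using True G0 by (auto intro!: sum_nonneg)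
    finally show ?thesis .
  next
    case False
    let ?P = "\<lambda>k. i div L ^ k = (i + d) div L ^ k"
    \<comment> \<open>\<open>L ^ k\<close> is the side of the smallest ancestor square common to both squares.\<close>
    define k where "k = (LEAST k. ?P k)"
    have Pn: "?P n" using that by (simp add: N_def)
    have Pk: "?P k" and kn: "k \<le> n" unfolding k_def
      using LeastI[of ?P, OF Pn] Least_le[of ?P, OF Pn] by auto
    have "\<not> ?P 0" using that by simp
    then have k1: "1 \<le> k" using Pk by (cases k) auto
    then have nP: "\<not> ?P (k - 1)" unfolding k_def by (intro not_less_Least) (simp add: k_def)
    have close: "b < a + K" if "a div K = b div K" "K > 0" for a b K :: nat
    proof -
      have "b = a div K * K + b mod K" "b mod K < K" using that by simp_all
      moreover have "a div K * K \<le> a" by simp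
      ultimately show ?thesis by linarith
    qed
    have Lk: "L ^ k > 0" using L by simp
    have dk: "d \<le> L ^ k" using close[OF Pk Lk] by simp
    have fk: "f i div L ^ k = f (i + d) div L ^ k"
      using nested[OF kn _ _ Pk] that by (simp add: N_def)
    have "int (f i) - int (f (i + d)) < int (L ^ k)" "int (f (i + d)) - int (f i) < int (L ^ k)"
      using close[OF fk Lk] close[OF fk[symmetric] Lk] by linarith+
    then have h: "\<bar>int (f i) - int (f (i + d))\<bar> \<le> int (L ^ k)" by linarith
    \<comment> \<open>The minimum in \<open>G\<close> combines two bounds on the vertical distance:
      L^k from the common ancestor and 2nd from the cutoff beyond which \<open>c\<close>
      vanishes.\<close>
    have "c i (i + d) \<le> G k d"
    proof (cases "\<bar>int (f i) - int (f (i + d))\<bar> \<le> 2 * int n * int d")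
      case True
      define H where "H = \<bar>int (f i) - int (f (i + d))\<bar>"
      have "real_of_int H \<le> real_of_int (int (L ^ k))" "real_of_int H \<le> real_of_int (2 * int n * int d)"
        using h True unfolding H_def by (simp_all only: of_int_le_iff)
      then have "real_of_int H \<le> min (real (L ^ k)) (2 * real n * real d)" by simp
      moreover have "c i (i + d) = 3 * real_of_int H / (real d)\<^sup>2"
        using that False True by (simp add: c_def overlap_bound_def H_def)
      ultimately show ?thesis unfolding G_def by (simp add: divide_right_mono)
    next
      case False
      then have "c i (i + d) = 0" using that \<open>d \<noteq> 1\<close> by (simp add: c_def overlap_bound_def)
      then show ?thesis using G0 by simp
    qed
    also have "G k d = (if d \<le> L ^ k \<and> i div L ^ (k - 1) \<noteq> (i + d) div L ^ (k - 1) then G k d else 0)"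
      using dk nP by simp
    also have "\<dots> \<le> (\<Sum>k=1..n. if d \<le> L ^ k \<and> i div L ^ (k - 1) \<noteq> (i + d) div L ^ (k - 1) then G k d else 0)"
      using k1 kn G0 by (intro member_le_sum) auto
    finally show ?thesis using False by (simp add: T_def)
  qed
  \<comment> \<open>With b = L^(k-1), at most N d/b columns are separated, and L^k = L b turns (N
    d/b) \<open>G k d\<close> into 3 N L min(1/d, 2n/L^k).\<close>
  have level: "(\<Sum>i<N. \<Sum>d=1..N. if d \<le> L ^ k \<and> i div L ^ (k - 1) \<noteq> (i + d) div L ^ (k - 1) then G k d else 0)
      \<le> real N * (6 * real L * ln (1 + 2 * real n))" if k: "k \<in> {1..n}" for k
  proof -
    define b where "b = L ^ (k - 1)"
    have b: "b > 0" "b dvd N" "L ^ k = L * b"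
      using L k unfolding b_def N_def by (auto intro: le_imp_power_dvd simp flip: power_Suc)
    have kN: "L ^ k \<le> N" using L k unfolding N_def by (intro power_increasing) auto
    have "(\<Sum>i<N. \<Sum>d=1..N. if d \<le> L ^ k \<and> i div b \<noteq> (i + d) div b then G k d else 0)
        = (\<Sum>d=1..N. \<Sum>i<N. if d \<le> L ^ k \<and> i div b \<noteq> (i + d) div b then G k d else 0)"
      by (rule sum.swap)
    also have "\<dots> = (\<Sum>d=1..L ^ k. \<Sum>i<N. if i div b \<noteq> (i + d) div b then G k d else 0)"
      using kN by (intro sum.mono_neutral_cong_right) auto
    also have "\<dots> = (\<Sum>d=1..L ^ k. real (card {i. i < N \<and> i div b \<noteq> (i + d) div b}) * G k d)"
      by (intro sum.cong refl) (simp add: sum.If_cases Int_def)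
    also have "\<dots> \<le> (\<Sum>d=1..L ^ k. (real N / real b * real d) * G k d)"
    proof (intro sum_mono mult_right_mono G0)
      fix d
      have "real (card {i. i < N \<and> i div b \<noteq> (i + d) div b}) \<le> real (N div b * d)"
        using card_div_neq_add_div_le[OF b(1,2)] by (simp only: of_nat_le_iff)
      then show "real (card {i. i < N \<and> i div b \<noteq> (i + d) div b}) \<le> real N / real b * real d"
        using b by (simp add: real_of_nat_div)
    qed
    also have "\<dots> = (\<Sum>d=1..L ^ k. 3 * real N * real L * min (1 / real d) (2 * real n / real (L ^ k)))"
    proof (intro sum.cong refl)
      fix d assume "d \<in> {1..L ^ k}"
      then have d: "real d > 0" by simp
      have "min (real (L ^ k)) (2 * real n * real d)
          = real d * real (L ^ k) * min (1 / real d) (2 * real n / real (L ^ k))"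
        using d L by (auto simp: min_mult_distrib_left mult_ac)
      then show "(real N / real b * real d) * G k d
          = 3 * real N * real L * min (1 / real d) (2 * real n / real (L ^ k))"
        unfolding G_def using d b by (simp add: power2_eq_square)
    qed
    also have "\<dots> \<le> 3 * real N * real L * (2 * ln (1 + 2 * real n))"
      unfolding sum_distrib_left[symmetric] using L n
      by (intro mult_left_mono sum_min_inverse_le_ln) auto
    finally show ?thesis unfolding b_def by (simp add: mult_ac)
  qed
  have "(\<Sum>i<N. \<Sum>d=1..N. T i d) =
      (\<Sum>i<N. \<Sum>d=1..N. if d = 1 then real n else 0) +
      (\<Sum>i<N. \<Sum>d=1..N. \<Sum>k=1..n. if d \<le> L ^ k \<and> i div L ^ (k - 1) \<noteq> (i + d) div L ^ (k - 1) then G k d else 0)"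
    by (simp add: T_def sum.distrib)
  also have "(\<Sum>i<N. \<Sum>d=1..N. if d = 1 then real n else 0) \<le> real N * real n"
    by simp
  also have "(\<Sum>i<N. \<Sum>d=1..N. \<Sum>k=1..n. if d \<le> L ^ k \<and> i div L ^ (k - 1) \<noteq> (i + d) div L ^ (k - 1) then G k d else 0)
      = (\<Sum>k=1..n. \<Sum>i<N. \<Sum>d=1..N. if d \<le> L ^ k \<and> i div L ^ (k - 1) \<noteq> (i + d) div L ^ (k - 1) then G k d else 0)"
    by (simp only: sum.swap[of _ "{1..n}"])
  also have "\<dots> \<le> (\<Sum>k=1..n. real N * (6 * real L * ln (1 + 2 * real n)))"
    by (intro sum_mono level)
  finally have Tsum: "(\<Sum>i<N. \<Sum>d=1..N. T i d) \<le> real N * real n + real n * (real N * (6 * real L * ln (1 + 2 * real n)))"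
    by simp
  have "(\<Sum>i<N. \<Sum>d\<in>{1..<N - i}. c i (i + d)) \<le> (\<Sum>i<N. \<Sum>d\<in>{1..<N - i}. T i d)"
    by (intro sum_mono cT) auto
  \<comment> \<open>A range of \<open>d\<close> independent of \<open>i\<close> allows the sums to
    be exchanged.\<close>
  also have "\<dots> \<le> (\<Sum>i<N. \<Sum>d=1..N. T i d)"
    by (intro sum_mono sum_mono2 T0) auto
  also note Tsum
  finally have "(\<Sum>i<N. \<Sum>d\<in>{1..<N - i}. c i (i + d))
      \<le> real N * real n + real n * (real N * (6 * real L * ln (1 + 2 * real n)))" .
  moreover have "c i j = c j i" for i j
    using overlap_bound_minus[of n "int j - int i" "int (f j) - int (f i)"] by (simp add: c_def)
  then have "(\<Sum>i<N. \<Sum>j<N. c i j) = (\<Sum>i<N. c i i) + 2 * (\<Sum>i<N. \<Sum>d\<in>{1..<N - i}. c i (i + d))"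
    by (rule sum_square_symmetric)
  moreover have "(\<Sum>i<N. c i i) = real N * real n" by (simp add: c_def overlap_bound_def)
  ultimately have "(\<Sum>i<N. \<Sum>j<N. c i j) \<le> real N * real n * (3 + 12 * real L * ln (1 + 2 * real n))"
    by (simp add: algebra_simps)
  then show ?thesis by (simp only: c_def N_def)
qed

section \<open>Nestedness of rows across generations\<close>

text \<open>The midpoint of a fine cell never lies on the boundary of a coarse cell, since 2a+1 is
  odd; hence even closed coarse cells are determined by it.\<close>

lemma floor_cell_unique:
  fixes a K J :: nat
  assumes "K > 0" "real J / real M \<le> (real a + 1 / 2) / real (M * K)"
    "(real a + 1 / 2) / real (M * K) \<le> (real J + 1) / real M" "M > 0"
  shows "a div K = J"
proof -
  have "(real a + 1 / 2) / real (M * K) = ((real a + 1 / 2) / real K) / real M" by simp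
  with assms have "real J \<le> (real a + 1 / 2) / real K" "(real a + 1 / 2) / real K \<le> real J + 1"
    by (simp_all only: divide_le_cancel of_nat_0_less_iff split: if_splits)
  then have "real J * real K \<le> real a + 1 / 2" "real a + 1 / 2 \<le> (real J + 1) * real K"
    using assms(1) by (simp_all only: pos_le_divide_eq pos_divide_le_eq of_nat_0_less_iff)
  then have "real (2 * (J * K)) \<le> real (2 * a + 1)" "real (2 * a + 1) \<le> real (2 * ((J + 1) * K))"
    by (simp_all add: algebra_simps)
  then have "2 * (J * K) \<le> 2 * a + 1" "2 * a + 1 \<le> 2 * ((J + 1) * K)"
    by (simp_all only: of_nat_le_iff)
  then have "J * K \<le> a" "a < (J + 1) * K" by presburger+
  then show ?thesis by (intro div_nat_eqI) (simp_all add: mult.commute)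
qed

text \<open>The centre of each fine square lies in a square of \<open>S'\<close>, whose row is a
  function of its column; so the coarse row of a fine square depends only on its coarse
  column.\<close>

lemma one_per_column_nested:
  assumes L: "L \<ge> 2" and m: "one_per_column L m S'" and sub: "S \<subseteq> S'" and mn: "m \<le> n"
    and S: "S = (\<Union>i < L ^ n. grid_square L n i (f i))"
    and ij: "i < L ^ n" "j < L ^ n" "i div L ^ (n - m) = j div L ^ (n - m)"
  shows "f i div L ^ (n - m) = f j div L ^ (n - m)"
proof -
  obtain g where S': "S' = (\<Union>I < L ^ m. grid_square L m I (g I))"
    using m by (auto simp: one_per_column_def)
  have M: "L ^ n = L ^ m * L ^ (n - m)" using mn by (simp flip: power_add)
  have key: "f a div L ^ (n - m) = g (a div L ^ (n - m))" if a: "a < L ^ n" for a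
  proof -
    let ?p = "((real a + 1 / 2) / real L ^ n, (real (f a) + 1 / 2) / real L ^ n)"
    have "?p \<in> grid_square L n a (f a)" by (auto simp: grid_square_def divide_right_mono)
    then have "?p \<in> S'" using S sub a by blast
    then obtain I where I: "?p \<in> grid_square L m I (g I)" using S' by blast
    have Mr: "real L ^ n = real (L ^ m * L ^ (n - m))" "real L ^ m = real (L ^ m)"
      by (simp_all flip: M)
    have "a div L ^ (n - m) = I"
      using I L unfolding grid_square_def Mr by (intro floor_cell_unique[of _ _ "L ^ m"]) auto
    moreover have "f a div L ^ (n - m) = g I"
      using I L unfolding grid_square_def Mr by (intro floor_cell_unique[of _ _ "L ^ m"]) auto
    ultimately show ?thesis by simp
  qed
  show ?thesis using key[OF ij(1)] key[OF ij(2)] ij(3) by simp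
qed

section \<open>Projection at a single angle\<close>

text \<open>The second moment bound is applied to the projected bottom edges alone: \<open>N\<close>
  intervals of length sin \<theta> / N. Dividing their overlap condition by cos \<theta> / N puts it
  in terms of tan \<theta>.\<close>

lemma measure_proj_ge:
  assumes L: "L \<ge> 2" and S: "S = (\<Union>i < L ^ n. grid_square L n i (f i))"
    and th: "0 < cos \<theta>" "0 < sin \<theta>"
  shows "2 * l * sin \<theta> - l\<^sup>2 / real (L ^ n) * (\<Sum>i<L ^ n. \<Sum>j<L ^ n.
      if \<bar>real_of_int (int i - int j) * tan \<theta> - real_of_int (int (f i) - int (f j))\<bar> < tan \<theta> then 1 else 0)
    \<le> measure lebesgue (proj \<theta> ` S)"
proof -
  define N where "N = L ^ n"
  have N: "real N > 0" using L by (simp add: N_def)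
  define w where "w = sin \<theta> / real N"
  \<comment> \<open>Since sin \<theta> > 0, the right end of the bottom edge projects to the left
    end of the interval.\<close>
  define x where "x i = (real (f i) * cos \<theta> - (real i + 1) * sin \<theta>) / real N" for i
  define Q where "Q i j \<longleftrightarrow> \<bar>real_of_int (int i - int j) * tan \<theta> - real_of_int (int (f i) - int (f j))\<bar> < tan \<theta>" for i j
  have w: "0 \<le> w" "w \<le> 1 / real N" using th N by (auto simp: w_def divide_right_mono)
  have Q: "\<bar>x i - x j\<bar> < w \<longleftrightarrow> Q i j" for i j
  proof -
    have "x i - x j = - (cos \<theta> / real N) * (real_of_int (int i - int j) * tan \<theta> - real_of_int (int (f i) - int (f j)))"
      using th N by (simp add: x_def tan_def field_simps)
    moreover have "w = cos \<theta> / real N * tan \<theta>" using th by (simp add: w_def tan_def)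
    ultimately show ?thesis using th N
      by (simp add: Q_def abs_mult mult_less_cancel_left_pos divide_less_cancel)
  qed
  have sub: "(\<Union>i<N. {x i..x i + w}) \<subseteq> proj \<theta> ` S"
  proof
    fix y assume "y \<in> (\<Union>i<N. {x i..x i + w})"
    then obtain i where i: "i < N" and y: "y \<in> {x i..x i + w}" by blast
    \<comment> \<open>\<open>s = t / N\<close> is the abscissa of the point of the bottom edge that
      projects to \<open>y\<close>.\<close>
    define t where "t = (real (f i) * cos \<theta> - y * real N) / sin \<theta>"
    define s where "s = t / real N"
    have "real (f i) * cos \<theta> - (real i + 1) * sin \<theta> \<le> y * real N"
      using y N by (simp add: x_def pos_divide_le_eq)
    moreover have "x i + w = (real (f i) * cos \<theta> - real i * sin \<theta>) / real N"
      by (simp add: x_def w_def add_divide_distrib diff_divide_distrib algebra_simps)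
    then have "y * real N \<le> real (f i) * cos \<theta> - real i * sin \<theta>"
      using y N by (simp add: pos_le_divide_eq)
    ultimately have "real i \<le> t" "t \<le> real i + 1"
      using th by (simp_all add: t_def pos_le_divide_eq pos_divide_le_eq)
    then have "real i / real N \<le> s" "s \<le> (real i + 1) / real N"
      unfolding s_def by (simp_all add: divide_right_mono)
    then have "(s, real (f i) / real N) \<in> grid_square L n i (f i)"
      by (auto simp: grid_square_def N_def divide_right_mono)
    then have "(s, real (f i) / real N) \<in> S" using S i by (auto simp: N_def)
    moreover have "y = proj \<theta> (s, real (f i) / real N)"
      using th N by (simp add: proj_def s_def t_def field_simps)
    ultimately show "y \<in> proj \<theta> ` S" by blast
  qed
  have "compact (proj \<theta> ` S)" unfolding S proj_def grid_square_def
    by (intro compact_continuous_image continuous_intros compact_UN compact_Times) auto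
  then have "measure lebesgue (\<Union>i<N. {x i..x i + w}) \<le> measure lebesgue (proj \<theta> ` S)"
    by (intro measure_mono_fmeasurable sub lmeasurable_compact fmeasurableD fmeasurable.finite_UN) auto
  moreover have "2 * l * real (card {..<N}) * w - l\<^sup>2 * (\<Sum>i<N. \<Sum>j<N. if \<bar>x i - x j\<bar> < w then w else 0)
      \<le> measure lebesgue (\<Union>i<N. {x i..x i + w})"
    using w by (intro measure_Union_intervals_ge) auto
  moreover have "2 * l * real (card {..<N}) * w = 2 * l * sin \<theta>" using N by (simp add: w_def)
  moreover have "(\<Sum>i<N. \<Sum>j<N. if \<bar>x i - x j\<bar> < w then w else 0) \<le> (\<Sum>i<N. \<Sum>j<N. 1 / real N * (if Q i j then 1 else 0))"
    unfolding Q using w by (intro sum_mono) auto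
  then have "l\<^sup>2 * (\<Sum>i<N. \<Sum>j<N. if \<bar>x i - x j\<bar> < w then w else 0)
      \<le> l\<^sup>2 * (1 / real N * (\<Sum>i<N. \<Sum>j<N. if Q i j then 1 else 0))"
    unfolding sum_distrib_left[symmetric] by (intro mult_left_mono) auto
  then have "l\<^sup>2 * (\<Sum>i<N. \<Sum>j<N. if \<bar>x i - x j\<bar> < w then w else 0)
      \<le> l\<^sup>2 / real N * (\<Sum>i<N. \<Sum>j<N. if Q i j then 1 else 0)" by simp
  ultimately show ?thesis unfolding Q_def N_def[symmetric] by linarith
qed

section \<open>Integrals over the angle\<close>

lemma has_integral_tan:
  assumes "- (pi / 2) < a" "a \<le> b" "b < pi / 2"
  shows "(tan has_integral ln (cos a) - ln (cos b)) {a..b}"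
proof -
  have "(tan has_integral - ln (cos b) - (- ln (cos a))) {a..b}"
  proof (rule fundamental_theorem_of_calculus[OF assms(2)])
    fix x assume "x \<in> {a..b}"
    then have "cos x > 0" using assms by (intro cos_gt_zero_pi) auto
    then show "((\<lambda>x. - ln (cos x)) has_vector_derivative tan x) (at x within {a..b})"
      by (auto intro!: derivative_eq_intros simp: tan_def simp flip: has_real_derivative_iff_has_vector_derivative)
  qed
  then show ?thesis by simp
qed

text \<open>The weight is the derivative of tan, so a window in u = tan \<theta> contributes exactly
  its length in u.\<close>

lemma has_integral_sec_squared_window:
  assumes "a \<le> arctan \<alpha>" "\<alpha> \<le> \<beta>" "arctan \<beta> \<le> b"
  shows "((\<lambda>\<theta>. if \<theta> \<in> {arctan \<alpha>..arctan \<beta>} then 1 + (tan \<theta>)\<^sup>2 else 0) has_integral \<beta> - \<alpha>) {a..b}"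
proof -
  have "((\<lambda>\<theta>. 1 + (tan \<theta>)\<^sup>2) has_integral tan (arctan \<beta>) - tan (arctan \<alpha>)) {arctan \<alpha>..arctan \<beta>}"
  proof (rule fundamental_theorem_of_calculus)
    fix x assume "x \<in> {arctan \<alpha>..arctan \<beta>}"
    then have "cos x > 0" using arctan_lbound[of \<alpha>] arctan_ubound[of \<beta>]
      by (intro cos_gt_zero_pi) auto
    then show "(tan has_vector_derivative 1 + (tan x)\<^sup>2) (at x within {arctan \<alpha>..arctan \<beta>})"
      by (auto intro!: derivative_eq_intros simp: tan_sec power_inverse simp flip: has_real_derivative_iff_has_vector_derivative)
  qed (use assms in \<open>simp add: arctan_le_iff\<close>)
  then show ?thesis
    using assms by (subst has_integral_restrict) (auto simp: tan_arctan)
qed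

section \<open>Integration over the angles and choice of constants\<close>

text \<open>With a = 1/(100 L), integrating over tan \<theta> in [1, n] gives a linear term of at
  least (7/10) a ln n / n and a quadratic loss of at most (41/100) a ln n / n. The remaining 29/100
  exceeds 1/4, which yields 1/(400 L).\<close>

lemma Fav_ge:
  fixes S :: "nat \<Rightarrow> (real \<times> real) set"
  assumes L: "L \<ge> 2" and n: "n \<ge> 2"
    and dec: "\<And>n. S (Suc n) \<subseteq> S n" and cols: "\<And>n. one_per_column L n (S n)"
  shows "Fav (S n) \<ge> 1 / (400 * real L) * ln (real n) / real n"
proof -
  define N where "N = L ^ n"
  have N: "real N > 0" using L by (simp add: N_def)
  obtain f where f: "S n = (\<Union>i < L ^ n. grid_square L n i (f i))"
    using cols[of n] by (auto simp: one_per_column_def)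
  \<comment> \<open>\<open>k\<close> counts generations upwards from the finest, so it refers to
    \<open>S (n - k)\<close>.\<close>
  have nested: "f i div L ^ k = f j div L ^ k"
    if "k \<le> n" "i < L ^ n" "j < L ^ n" "i div L ^ k = j div L ^ k" for k i j
  proof -
    have "S n \<subseteq> S (n - k)" by (rule lift_Suc_antimono_le[where f=S]) (use dec in auto)
    then show ?thesis
      using one_per_column_nested[OF L cols _ _ f, of "n - k" i j] that by simp
  qed
  define a where "a = 1 / (100 * real L)"
  have a: "a > 0" using L by (simp add: a_def)
  let ?d = "\<lambda>i j. int i - int j" and ?h = "\<lambda>i j. int (f i) - int (f j)"
  have "\<forall>i j. \<exists>\<alpha> \<beta>. 1 \<le> \<alpha> \<and> \<alpha> \<le> \<beta> \<and> \<beta> \<le> real n \<and> \<beta> - \<alpha> \<le> overlap_bound n (?d i j) (?h i j) \<and>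
    (\<forall>u\<in>{1..real n}. \<bar>real_of_int (?d i j) * u - real_of_int (?h i j)\<bar> < u \<longrightarrow> u \<in> {\<alpha>..\<beta>})"
    by (intro allI overlap_window) (use n in simp)
  then obtain \<alpha> \<beta> where
    \<alpha>\<beta>: "\<And>i j. 1 \<le> \<alpha> i j" "\<And>i j. \<alpha> i j \<le> \<beta> i j" "\<And>i j. \<beta> i j \<le> real n"
      "\<And>i j. \<beta> i j - \<alpha> i j \<le> overlap_bound n (?d i j) (?h i j)"
    and window: "\<And>i j u. \<lbrakk>u \<in> {1..real n}; \<bar>real_of_int (?d i j) * u - real_of_int (?h i j)\<bar> < u\<rbrakk>
      \<Longrightarrow> u \<in> {\<alpha> i j..\<beta> i j}"
    by metis
  \<comment> \<open>When the edges overlap, tan^2 \<le> 1 + tan^2 = \<open>W i j \<theta>\<close>.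
    As the multiplier \<open>l\<close> below is proportional to tan \<theta>, its square is thus
    absorbed into the Jacobian of u = tan \<theta>.\<close>
  define W where "W i j \<theta> = (if \<theta> \<in> {arctan (\<alpha> i j)..arctan (\<beta> i j)} then 1 + (tan \<theta>)\<^sup>2 else 0)" for i j \<theta>
  define \<phi> where "\<phi> \<theta> = a / real n * sqrt 2 * tan \<theta> - a\<^sup>2 / (real n)\<^sup>2 / real N * (\<Sum>i<N. \<Sum>j<N. W i j \<theta>)" for \<theta>
  define v where "v = a / real n * sqrt 2 * (ln (cos (pi / 4)) - ln (cos (arctan (real n))))
      - a\<^sup>2 / (real n)\<^sup>2 / real N * (\<Sum>i<N. \<Sum>j<N. \<beta> i j - \<alpha> i j)"
  have J: "pi / 4 \<le> arctan (real n)" "arctan (real n) < pi / 2"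
    using n arctan_le_iff[of 1 "real n"] by (simp add: arctan_one) (rule arctan_ubound)
  have W: "(W i j has_integral \<beta> i j - \<alpha> i j) {pi / 4..arctan (real n)}" for i j
    unfolding W_def using \<alpha>\<beta>[of i j] arctan_le_iff[of 1 "\<alpha> i j"]
    by (intro has_integral_sec_squared_window) (simp_all add: arctan_one arctan_le_iff)
  have \<phi>: "(\<phi> has_integral v) {pi / 4..arctan (real n)}"
    unfolding \<phi>_def v_def using J pi_gt_zero
    by (intro has_integral_diff has_integral_mult_right has_integral_tan has_integral_sum W) auto
  have le: "\<phi> \<theta> \<le> measure lebesgue (proj \<theta> ` S n)" if th: "\<theta> \<in> {pi / 4..arctan (real n)}" for \<theta>
  proof -
    have \<theta>: "pi / 4 \<le> \<theta>" "\<theta> < pi / 2" "\<theta> \<le> arctan (real n)" using th J by auto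
    have "sin (pi / 4) \<le> sin \<theta>" using \<theta> by (intro sin_monotone_2pi_le) auto
    then have sin: "sqrt 2 / 2 \<le> sin \<theta>" by (simp add: sin_45)
    then have sin0: "0 < sin \<theta>" by (rule less_le_trans[rotated]) simp
    have cos: "0 < cos \<theta>" using \<theta> pi_gt_zero by (intro cos_gt_zero_pi) auto
    have at: "arctan (tan \<theta>) = \<theta>" using \<theta> pi_gt_zero by (intro arctan_tan) auto
    have u: "tan \<theta> \<in> {1..real n}"
      using \<theta> arctan_le_iff[of 1 "tan \<theta>"] arctan_le_iff[of "tan \<theta>" "real n"]
      by (simp add: at arctan_one)
    \<comment> \<open>proportional to the reciprocal of the expected multiplicity at \<open>\<theta>\<close>\<close>
    define l where "l = a * tan \<theta> / real n"
    let ?Q = "\<lambda>i j. \<bar>real_of_int (?d i j) * tan \<theta> - real_of_int (?h i j)\<bar> < tan \<theta>"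
    have "l\<^sup>2 * (if ?Q i j then 1 else 0) \<le> a\<^sup>2 / (real n)\<^sup>2 * W i j \<theta>" for i j
    proof (cases "?Q i j")
      case True
      then have "arctan (\<alpha> i j) \<le> arctan (tan \<theta>)" "arctan (tan \<theta>) \<le> arctan (\<beta> i j)"
        using window[OF u True] by (simp_all add: arctan_le_iff)
      then have "W i j \<theta> = 1 + (tan \<theta>)\<^sup>2" by (simp add: W_def at)
      then show ?thesis using True
        by (simp add: l_def power_mult_distrib power_divide distrib_left divide_right_mono)
    next
      case False
      then show ?thesis by (simp add: W_def)
    qed
    then have "(\<Sum>i<N. \<Sum>j<N. l\<^sup>2 * (if ?Q i j then 1 else 0)) \<le> (\<Sum>i<N. \<Sum>j<N. a\<^sup>2 / (real n)\<^sup>2 * W i j \<theta>)"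
      by (intro sum_mono)
    then have "(\<Sum>i<N. \<Sum>j<N. l\<^sup>2 * (if ?Q i j then 1 else 0)) / real N
        \<le> (\<Sum>i<N. \<Sum>j<N. a\<^sup>2 / (real n)\<^sup>2 * W i j \<theta>) / real N"
      by (intro divide_right_mono) auto
    then have "l\<^sup>2 / real N * (\<Sum>i<N. \<Sum>j<N. if ?Q i j then 1 else 0)
        \<le> a\<^sup>2 / (real n)\<^sup>2 / real N * (\<Sum>i<N. \<Sum>j<N. W i j \<theta>)"
      unfolding sum_distrib_left[symmetric] by simp
    moreover have "l * (sqrt 2 / 2) \<le> l * sin \<theta>"
      using sin u a by (intro mult_left_mono) (auto simp: l_def)
    then have "sqrt 2 * l \<le> 2 * l * sin \<theta>" by (simp add: mult_ac)
    then have "a / real n * sqrt 2 * tan \<theta> \<le> 2 * l * sin \<theta>" by (simp add: l_def mult_ac)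
    ultimately have "\<phi> \<theta> \<le> 2 * l * sin \<theta> - l\<^sup>2 / real N * (\<Sum>i<N. \<Sum>j<N. if ?Q i j then 1 else 0)"
      unfolding \<phi>_def by linarith
    also have "\<dots> \<le> measure lebesgue (proj \<theta> ` S n)"
      unfolding N_def by (rule measure_proj_ge[OF L f cos sin0])
    finally show ?thesis .
  qed
  have "compact (S n)" unfolding f grid_square_def
    by (intro compact_UN compact_Times) auto
  moreover have "{pi / 4..arctan (real n)} \<subseteq> {0..pi}"
    using J(2) pi_gt_zero by auto
  ultimately have v: "v \<le> Fav (S n)" using \<phi> le by (rule Fav_ge_integral)
  have n2: "real n \<ge> 2" using n by simp
  have ln23: "2 / 3 \<le> ln (real n)"
    using ln2_ge_two_thirds n2 ln_mono[of 2 "real n"] by linarith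
  \<comment> \<open>The difference equals (1/2) ln((1+n^2)/2), and (1+n^2)/2 \<ge> n.\<close>
  have main: "ln (real n) / 2 \<le> ln (cos (pi / 4)) - ln (cos (arctan (real n)))"
  proof -
    have pos: "0 < 1 + (real n)\<^sup>2" by (simp add: add_pos_nonneg)
    have "0 \<le> (real n - 1)\<^sup>2" by simp
    then have "real n \<le> (1 + (real n)\<^sup>2) / 2" by (simp add: power2_eq_square algebra_simps)
    then have "ln (real n) \<le> ln ((1 + (real n)\<^sup>2) / 2)" using n2 by (intro ln_mono) auto
    also have "\<dots> = ln (1 + (real n)\<^sup>2) - ln 2" using pos by (simp add: ln_div)
    finally have "ln (real n) / 2 \<le> ln (1 + (real n)\<^sup>2) / 2 - ln 2 / 2" by simp
    moreover have "ln (cos (arctan (real n))) = - (ln (1 + (real n)\<^sup>2) / 2)"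
      using pos by (simp add: cos_arctan ln_div ln_sqrt)
    moreover have "ln (cos (pi / 4)) = - (ln 2 / 2)"
      by (simp add: cos_45 ln_div ln_sqrt)
    ultimately show ?thesis by simp
  qed
  have "1 + 2 * real n \<le> real n ^ 3"
  proof -
    have "2 * 2 * real n \<le> real n * real n * real n" using n2 by (intro mult_mono) auto
    then show ?thesis unfolding power3_eq_cube using n2 by linarith
  qed
  then have "ln (1 + 2 * real n) \<le> ln (real n ^ 3)" using n2 by (intro ln_mono) auto
  then have ln3: "ln (1 + 2 * real n) \<le> 3 * ln (real n)" using n2 by (simp add: ln_realpow)
  have "(\<Sum>i<N. \<Sum>j<N. \<beta> i j - \<alpha> i j) \<le> (\<Sum>i<N. \<Sum>j<N. overlap_bound n (?d i j) (?h i j))"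
    by (intro sum_mono \<alpha>\<beta>)
  also have "\<dots> \<le> real N * real n * (3 + 12 * real L * ln (1 + 2 * real n))"
    unfolding N_def using n by (intro sum_overlap_bound_le L nested) auto
  \<comment> \<open>36 comes from 12 times the 3 in \<open>ln3\<close>; the summand 3 is absorbed by
    5 L ln n, as L ln n \<ge> 4/3.\<close>
  also have "\<dots> \<le> real N * real n * (41 * real L * ln (real n))"
  proof (rule mult_left_mono)
    have "real L * ln (1 + 2 * real n) \<le> real L * (3 * ln (real n))" using ln3 by (intro mult_left_mono) auto
    moreover have "2 * (2 / 3) \<le> real L * ln (real n)" using L ln23 by (intro mult_mono) auto
    ultimately show "3 + 12 * real L * ln (1 + 2 * real n) \<le> 41 * real L * ln (real n)" by linarith
  qed simp
  finally have "a\<^sup>2 / (real n)\<^sup>2 / real N * (\<Sum>i<N. \<Sum>j<N. \<beta> i j - \<alpha> i j)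
      \<le> a\<^sup>2 / (real n)\<^sup>2 / real N * (real N * real n * (41 * real L * ln (real n)))"
    by (intro mult_left_mono) auto
  also have "\<dots> = a * (41 / 100) * (ln (real n) / real n)"
    using N n2 L by (simp add: a_def power2_eq_square field_simps)
  finally have second: "a\<^sup>2 / (real n)\<^sup>2 / real N * (\<Sum>i<N. \<Sum>j<N. \<beta> i j - \<alpha> i j)
      \<le> a * (41 / 100) * (ln (real n) / real n)" .
  have "7 / 5 \<le> sqrt 2" by (rule real_le_rsqrt) (simp add: power2_eq_square)
  then have "a / real n * (7 / 5) * (ln (real n) / 2)
      \<le> a / real n * sqrt 2 * (ln (cos (pi / 4)) - ln (cos (arctan (real n))))"
    using main ln23 a by (intro mult_mono) auto
  with second have "a * (29 / 100) * (ln (real n) / real n) \<le> v"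
    unfolding v_def by (simp add: algebra_simps)
  moreover have "1 / (400 * real L) * ln (real n) / real n = a * (1 / 4) * (ln (real n) / real n)"
    by (simp add: a_def)
  moreover have "a * (1 / 4) * (ln (real n) / real n) \<le> a * (29 / 100) * (ln (real n) / real n)"
    using a ln23 by (intro mult_right_mono) auto
  ultimately show ?thesis using v by linarith
qed

theorem theoremA1:
  fixes L :: nat
  assumes "L \<ge> 2"
  shows "\<exists>c > 0. \<forall>S :: nat \<Rightarrow> (real \<times> real) set.
           S 0 = {0..1} \<times> {0..1} \<and> (\<forall>n. S (Suc n) \<subseteq> S n) \<and>
           (\<forall>n. one_per_column L n (S n)) \<longrightarrow>
           (\<forall>n \<ge> 2. Fav (S n) \<ge> c * ln (real n) / real n)"
  using assms Fav_ge[OF assms] by (intro exI[of _ "1 / (400 * real L)"]) auto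

end
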